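(* For each integer $n \geq 3$, \[ \vec{r}(S_n) \geq n^{\log n /(100 \log \log n)}. \]
   Context: The $(1,2)$-subdivision $S_n$ of the transitive tournament on $n$ vertices is the acyclic digraph with vertex set $[n] \cup \{ (i, j, k) \in [n]^3 : i < j < k\}$ and edge set $\{ (i, (i,j,k)), ((i, j, k), j), ((i,j,k), k) : 1 \leq i < j < k \leq n \}$ (an edge $(x,y)$ is directed from $x$ to $y$). For an acyclic digraph $D$, $\vec{r}(D)$ is the minimum integer $N$ such that every tournament on $N$ vertices contains a copy of $D$. Logarithms are natural. *)

theory Defs
  imports Complex_Main "Graph_Theory.Pair_Digraph"
begin

definition tournament :: "'a pair_pre_digraph \<Rightarrow> bool" where
  "tournament T \<longleftrightarrow> pair_digraph T \<and>
     (\<forall>u\<in>pverts T. \<forall>v\<in>pverts T. u \<noteq> v \<longrightarrow> ((u, v) \<in> parcs T) \<noteq> ((v, u) \<in> parcs T))"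

text \<open>A copy of \<open>D\<close> is a not necessarily induced subdigraph isomorphic to \<open>D\<close>.\<close>

definition contains_copy :: "'a pair_pre_digraph \<Rightarrow> 'b pair_pre_digraph \<Rightarrow> bool" where
  "contains_copy T D \<longleftrightarrow>
     (\<exists>f. inj_on f (pverts D) \<and> f ` pverts D \<subseteq> pverts T \<and>
          (\<forall>(u, v)\<in>parcs D. (f u, f v) \<in> parcs T))"

text \<open>Every finite tournament is isomorphic to one whose vertices are natural numbers, so
  quantifying over these loses nothing. The minimum exists whenever \<open>D\<close> is finite and
  acyclic.\<close>

definition oriented_ramsey :: "'b pair_pre_digraph \<Rightarrow> nat" where
  "oriented_ramsey D =
     (LEAST N. \<forall>T :: nat pair_pre_digraph.
        tournament T \<and> card (pverts T) = N \<longrightarrow> contains_copy T D)"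

text \<open>\<open>Inl i\<close> is the original vertex \<open>i\<close>, \<open>Inr (i, j, k)\<close> the subdivision vertex of the
  triple.\<close>

definition subdivision_12 :: "nat \<Rightarrow> (nat + nat \<times> nat \<times> nat) pair_pre_digraph" where
  "subdivision_12 n = \<lparr>
     pverts = Inl ` {1..n} \<union> {Inr (i, j, k) | i j k. 1 \<le> i \<and> i < j \<and> j < k \<and> k \<le> n},
     parcs = (\<Union>(i, j, k) \<in> {(i, j, k). 1 \<le> i \<and> i < j \<and> j < k \<and> k \<le> n}.
       {(Inl i, Inr (i, j, k)), (Inr (i, j, k), Inl j), (Inr (i, j, k), Inl k)}) \<rparr>"

lemma pair_digraph_subdivision_12: "pair_digraph (subdivision_12 n)"
proof -
  have fin: "finite {(i, j, k). 1 \<le> i \<and> i < j \<and> j < k \<and> k \<le> n}"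
    by (rule finite_subset[of _ "{1..n} \<times> {1..n} \<times> {1..n}"]) auto
  have eq: "{Inr (i, j, k) | i j k. 1 \<le> i \<and> i < j \<and> j < k \<and> k \<le> n} =
      Inr ` {(i, j, k). 1 \<le> i \<and> i < j \<and> j < k \<and> k \<le> n}"
    by auto
  show ?thesis
  proof unfold_locales
    show "finite (pverts (subdivision_12 n))"
      using fin by (simp only: subdivision_12_def eq) simp
    show "finite (parcs (subdivision_12 n))"
      unfolding subdivision_12_def using fin by auto
  qed (auto simp: subdivision_12_def)
qed

lemma acyclic_subdivision_12: "acyclic (parcs (subdivision_12 n))"
proof -
  define m :: "nat + nat \<times> nat \<times> nat \<Rightarrow> nat"
    where "m = case_sum (\<lambda>i. 2 * i) (\<lambda>(i, j, k). 2 * i + 1)"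
  have "parcs (subdivision_12 n) \<subseteq> measure m"
    by (auto simp: subdivision_12_def m_def)
  then show ?thesis
    by (meson acyclic_subset wf_acyclic wf_measure)
qed

end

theory Submission
  imports Defs "HOL-Library.Ramsey"
begin

text \<open>
  Take a tournament on \<open>m\<close> vertices whose transitive subtournaments have at most
  \<open>L = O(log m)\<close> vertices, and form its \<open>h\<close>-fold lexicographic power, with \<open>m ^ h\<close> vertices.
  Suppose that it contains a copy of the subdivision with \<open>n\<close> branch vertices, and look at the \<open>m\<close>
  top-level cells. If two cells each contain two branch vertices, then the cell whose branch
  vertices start first dominates the other. Hence at most \<open>L\<close> cells contain two or more branch
  vertices, each such cell inherits a copy of a smaller subdivision, and induction gives
  \<open>n + m \<le> (m + 1) * L ^ h\<close>. With \<open>m\<close> a small power of \<open>n\<close> and \<open>h\<close> of order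
  \<open>log n / log log n\<close> this fails for large \<open>n\<close>; for the remaining \<open>n\<close> the claimed bound
  is at most \<open>n\<close>.
\<close>

section \<open>Tournaments without large transitive subtournaments\<close>

text \<open>Asymmetry is asked on all of \<open>nat\<close>, so that it applies to cells without
  checking that they lie in \<open>V\<close>.\<close>

definition tournament_rel :: "nat set \<Rightarrow> (nat \<Rightarrow> nat \<Rightarrow> bool) \<Rightarrow> bool" where
  "tournament_rel V E \<longleftrightarrow> (\<forall>u v. E u v \<longrightarrow> \<not> E v u) \<and> (\<forall>u\<in>V. \<forall>v\<in>V. u \<noteq> v \<longrightarrow> E u v \<or> E v u)"

text \<open>Encodes a tournament by the set of its increasing arcs, so that counting tournaments
  becomes counting sets of pairs.\<close>

definition upper_rel :: "(nat \<times> nat) set \<Rightarrow> nat \<Rightarrow> nat \<Rightarrow> bool" where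
  "upper_rel S i j \<longleftrightarrow> (if i < j then (i, j) \<in> S else j < i \<and> (j, i) \<notin> S)"

lemma tournament_upper_rel: "tournament_rel V (upper_rel S)"
  by (auto simp: tournament_rel_def upper_rel_def)

lemma card_upper_pairs:
  fixes U :: "nat set"
  assumes "finite U"
  shows "2 * card {(i, j). i \<in> U \<and> j \<in> U \<and> i < j} + card U = card U * card U"
proof -
  let ?P = "{(i, j). i \<in> U \<and> j \<in> U \<and> i < j}"
  have fin: "finite ?P"
    by (rule finite_subset[of _ "U \<times> U"]) (use assms in auto)
  have "U \<times> U = (?P \<union> prod.swap ` ?P) \<union> (\<lambda>x. (x, x)) ` U"
    by (auto simp: image_iff)
  then have "card (U \<times> U) = card ((?P \<union> prod.swap ` ?P) \<union> (\<lambda>x. (x, x)) ` U)"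
    by simp
  also have "\<dots> = card (?P \<union> prod.swap ` ?P) + card ((\<lambda>x. (x, x)) ` U)"
    by (rule card_Un_disjoint) (use fin assms in auto)
  also have "card (?P \<union> prod.swap ` ?P) = card ?P + card (prod.swap ` ?P)"
    by (rule card_Un_disjoint) (use fin in auto)
  also have "card (prod.swap ` ?P) = card ?P"
    by (rule card_image) simp
  also have "card ((\<lambda>x. (x, x)) ` U) = card U"
    by (rule card_image) (simp add: inj_on_def)
  finally show ?thesis
    by (simp add: card_cartesian_product)
qed

text \<open>The positions of \<open>i\<close> and \<open>j\<close> in \<open>xs\<close> dictate the
  arc between them in both tournaments.\<close>

lemma sorted_wrt_upper_rel_eq:
  assumes "sorted_wrt (upper_rel S) xs" and "sorted_wrt (upper_rel S') xs"
    and "i \<in> set xs" and "j \<in> set xs" and "i < j"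
  shows "(i, j) \<in> S \<longleftrightarrow> (i, j) \<in> S'"
proof -
  obtain p q where pq: "p < length xs" "xs ! p = i" "q < length xs" "xs ! q = j"
    using assms by (meson in_set_conv_nth)
  then have "p \<noteq> q"
    using assms(5) by auto
  then consider "p < q" | "q < p"
    by linarith
  then show ?thesis
  proof cases
    case 1
    then have "upper_rel S i j" "upper_rel S' i j"
      using assms(1,2) pq by (auto simp: sorted_wrt_iff_nth_less)
    then show ?thesis
      using assms(5) by (simp add: upper_rel_def)
  next
    case 2
    then have "upper_rel S j i" "upper_rel S' j i"
      using assms(1,2) pq by (auto simp: sorted_wrt_iff_nth_less)
    then show ?thesis
      using assms(5) by (simp add: upper_rel_def)
  qed
qed

lemma sorted_wrt_upper_rel_distinct: "sorted_wrt (upper_rel S) xs \<Longrightarrow> distinct xs"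
  by (induction xs) (auto simp: upper_rel_def)

text \<open>A transitive list fixes all arcs among its \<open>k\<close> entries, so \<open>S\<close>
  is determined by its pairs outside \<open>P\<close>. The probability bound is multiplied out to
  stay in \<open>nat\<close>.\<close>

lemma card_transitive_list_le:
  assumes "set xs \<subseteq> {..<m}" and "length xs = k" and E: "E = {(i, j). i < j \<and> j < (m::nat)}"
  shows "card {S \<in> Pow E. sorted_wrt (upper_rel S) xs} * 2 ^ (k * (k - 1) div 2) \<le> 2 ^ card E"
proof (cases "distinct xs")
  case False
  then have "{S \<in> Pow E. sorted_wrt (upper_rel S) xs} = {}"
    using sorted_wrt_upper_rel_distinct by blast
  then show ?thesis
    by (simp only: card.empty)
next
  case True
  let ?B = "{S \<in> Pow E. sorted_wrt (upper_rel S) xs}"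
  define P where "P = {(i, j). i \<in> set xs \<and> j \<in> set xs \<and> i < j}"
  have finE: "finite E"
    unfolding E by (rule finite_subset[of _ "{..<m} \<times> {..<m}"]) auto
  have PE: "P \<subseteq> E"
    using assms(1) by (auto simp: P_def E)
  have "2 * card P + k = k * k"
    using card_upper_pairs[of "set xs"] True assms(2) by (simp add: P_def distinct_card)
  then have cardP: "card P = k * (k - 1) div 2"
    by (simp add: right_diff_distrib')
  have "inj_on (\<lambda>S. S - P) ?B"
  proof (rule inj_onI)
    fix S S' assume S: "S \<in> ?B" "S' \<in> ?B" "S - P = S' - P"
    have "x \<in> S \<longleftrightarrow> x \<in> S'" if "x \<in> P" for x
      using that S sorted_wrt_upper_rel_eq[of S xs S'] by (auto simp: P_def)
    then show "S = S'"
      using S(3) by blast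
  qed
  then have "card ?B = card ((\<lambda>S. S - P) ` ?B)"
    by (simp add: card_image)
  also have "\<dots> \<le> card (Pow (E - P))"
    by (rule card_mono) (use finE in auto)
  also have "\<dots> = 2 ^ (card E - card P)"
    using finE PE by (simp add: card_Pow card_Diff_subset finite_subset)
  finally have "card ?B * 2 ^ card P \<le> 2 ^ (card E - card P) * 2 ^ card P"
    by simp
  also have "\<dots> = 2 ^ card E"
    using card_mono[OF finE PE] by (simp flip: power_add)
  finally show ?thesis
    by (simp only: cardP)
qed

text \<open>Union bound over all ordered \<open>(L + 1)\<close>-tuples.\<close>

lemma exists_tournament_no_large_transitive:
  fixes m L :: nat
  assumes "m\<^sup>2 < 2 ^ L"
  obtains E where "tournament_rel {..<m} E"
    and "\<And>xs. set xs \<subseteq> {..<m} \<Longrightarrow> sorted_wrt E xs \<Longrightarrow> length xs \<le> L"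
proof -
  define A where "A = {(i, j). i < j \<and> j < m}"
  define X where "X = {xs. set xs \<subseteq> {..<m} \<and> length xs = Suc L}"
  define b where "b = Suc L * L div 2"
  let ?B = "\<lambda>xs. {S \<in> Pow A. sorted_wrt (upper_rel S) xs}"
  have finA: "finite A"
    unfolding A_def by (rule finite_subset[of _ "{..<m} \<times> {..<m}"]) auto
  have X: "finite X" "card X = m ^ Suc L"
    by (simp_all add: X_def finite_lists_length_eq card_lists_length_eq)
  have "even (Suc L * L)"
    by simp
  then have bb: "b * 2 = L * Suc L"
    unfolding b_def by (metis dvd_div_mult_self mult.commute)
  \<comment> \<open>Squaring removes the division by 2 in \<open>b\<close>.\<close>
  have "(m ^ Suc L)\<^sup>2 = (m\<^sup>2) ^ Suc L"
    by (metis power_mult mult.commute)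
  also have "\<dots> < (2 ^ L) ^ Suc L"
    using assms by (intro power_strict_mono) auto
  also have "\<dots> = (2 ^ b)\<^sup>2"
    by (simp only: power_mult[symmetric] bb)
  finally have small: "m ^ Suc L < 2 ^ b"
    by (rule power_less_imp_less_base) simp
  have "card (\<Union>xs\<in>X. ?B xs) * 2 ^ b \<le> (\<Sum>xs\<in>X. card (?B xs)) * 2 ^ b"
    using card_UN_le[OF X(1), of ?B] by (simp add: mult_right_mono)
  also have "\<dots> = (\<Sum>xs\<in>X. card (?B xs) * 2 ^ b)"
    by (simp add: sum_distrib_right)
  also have "\<dots> \<le> (\<Sum>xs\<in>X. 2 ^ card A)"
    using card_transitive_list_le[OF _ _ A_def, of _ "Suc L"]
    by (intro sum_mono) (auto simp: X_def b_def)
  also have "\<dots> = m ^ Suc L * 2 ^ card A"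
    by (simp add: X(2))
  also have "\<dots> < 2 ^ b * 2 ^ card A"
    using small by (intro mult_strict_right_mono) auto
  finally have "card (\<Union>xs\<in>X. ?B xs) < card (Pow A)"
    using finA by (simp add: card_Pow)
  then have "\<not> Pow A \<subseteq> (\<Union>xs\<in>X. ?B xs)"
    using finA X(1) card_mono[of "\<Union>xs\<in>X. ?B xs" "Pow A"] by fastforce
  then obtain S where S: "S \<in> Pow A" "\<And>xs. xs \<in> X \<Longrightarrow> \<not> sorted_wrt (upper_rel S) xs"
    by blast
  \<comment> \<open>A prefix of a transitive list is transitive, so it was enough to exclude length
    exactly \<open>Suc L\<close>.\<close>
  have "length xs \<le> L" if xs: "set xs \<subseteq> {..<m}" "sorted_wrt (upper_rel S) xs" for xs
  proof (rule ccontr)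
    assume "\<not> length xs \<le> L"
    then have "take (Suc L) xs \<in> X"
      using xs(1) set_take_subset[of "Suc L" xs] by (auto simp: X_def)
    then show False
      using S(2) sorted_wrt_take[OF xs(2)] by blast
  qed
  then show thesis
    using that tournament_upper_rel by blast
qed

section \<open>Lexicographic powers\<close>

text \<open>Vertices are base-\<open>m\<close> numerals with \<open>h\<close> digits; the most
  significant digit where two of them differ decides the arc. The leading digit is the top-level
  cell, the remainder the vertex inside it.\<close>

primrec lex_power :: "nat \<Rightarrow> (nat \<Rightarrow> nat \<Rightarrow> bool) \<Rightarrow> nat \<Rightarrow> nat \<Rightarrow> nat \<Rightarrow> bool" where
  "lex_power m E 0 x y = False"
| "lex_power m E (Suc h) x y =
     (if x div m ^ h = y div m ^ h then lex_power m E h (x mod m ^ h) (y mod m ^ h)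
      else E (x div m ^ h) (y div m ^ h))"

lemma tournament_lex_power:
  assumes "tournament_rel {..<m} E"
  shows "tournament_rel {..<m ^ h} (lex_power m E h)"
proof (induction h)
  case 0
  show ?case
    by (simp add: tournament_rel_def)
next
  case (Suc h)
  show ?case
    unfolding tournament_rel_def
  proof (intro conjI allI impI ballI)
    fix u v assume "lex_power m E (Suc h) u v"
    then show "\<not> lex_power m E (Suc h) v u"
      using assms Suc by (auto simp: tournament_rel_def split: if_splits)
  next
    fix u v assume uv: "u \<in> {..<m ^ Suc h}" "v \<in> {..<m ^ Suc h}" "u \<noteq> v"
    then have pos: "m ^ h > 0"
      by (auto intro!: Nat.gr0I)
    have cells: "u div m ^ h < m" "v div m ^ h < m"
      using uv by (auto simp: less_mult_imp_div_less)
    show "lex_power m E (Suc h) u v \<or> lex_power m E (Suc h) v u"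
    proof (cases "u div m ^ h = v div m ^ h")
      case True
      then have "u mod m ^ h \<noteq> v mod m ^ h"
        using uv(3) by (metis div_mult_mod_eq)
      then show ?thesis
        using True Suc pos by (auto simp: tournament_rel_def)
    next
      case False
      then show ?thesis
        using assms cells by (auto simp: tournament_rel_def)
    qed
  qed
qed

section \<open>Branch families in lexicographic powers\<close>

text \<open>What remains of a copy of the subdivision when only the branch vertices \<open>v i\<close> are
  recorded and the subdivision vertices need not be distinct. Arbitrary index sets make the notion
  hereditary.\<close>

definition branch_family ::
    "nat set \<Rightarrow> (nat \<Rightarrow> nat \<Rightarrow> bool) \<Rightarrow> nat set \<Rightarrow> (nat \<Rightarrow> nat) \<Rightarrow> bool" where
  "branch_family V E I v \<longleftrightarrow> inj_on v I \<and> v ` I \<subseteq> V \<and>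
     (\<forall>i\<in>I. \<forall>j\<in>I. \<forall>k\<in>I. i < j \<longrightarrow> j < k \<longrightarrow> (\<exists>w\<in>V. E (v i) w \<and> E w (v j) \<and> E w (v k)))"

text \<open>A witness \<open>w\<close> in another cell would be both dominated by cell
  \<open>c\<close> and dominate it, against asymmetry. So \<open>w\<close> lies in cell
  \<open>c\<close>, and its remainder is the witness one level down.\<close>

lemma branch_family_cell:
  assumes E: "tournament_rel {..<m} E"
    and fam: "branch_family {..<m ^ Suc h} (lex_power m E (Suc h)) I v"
  shows "branch_family {..<m ^ h} (lex_power m E h) {i \<in> I. v i div m ^ h = c} (\<lambda>i. v i mod m ^ h)"
    (is "branch_family _ _ ?J ?u")
proof -
  have asym: "\<not> E y x" if "E x y" for x y
    using E that by (auto simp: tournament_rel_def)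
  show ?thesis
    unfolding branch_family_def
  proof (intro conjI ballI impI)
    show "inj_on ?u ?J"
    proof (rule inj_onI)
      fix i j assume ij: "i \<in> ?J" "j \<in> ?J" "?u i = ?u j"
      then have "v i = v j"
        by (metis (mono_tags, lifting) div_mult_mod_eq mem_Collect_eq)
      then show "i = j"
        using ij fam by (auto simp: branch_family_def inj_on_def)
    qed
    show "?u ` ?J \<subseteq> {..<m ^ h}"
    proof
      fix x assume "x \<in> ?u ` ?J"
      then obtain i where i: "i \<in> I" "x = v i mod m ^ h"
        by auto
      then have "v i < m ^ Suc h"
        using fam by (auto simp: branch_family_def)
      then have "m ^ h > 0"
        by (auto intro!: Nat.gr0I)
      then show "x \<in> {..<m ^ h}"
        using i by simp
    qed
  next
    fix i j k assume ijk: "i \<in> ?J" "j \<in> ?J" "k \<in> ?J" "i < j" "j < k"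
    then obtain w where w: "w < m ^ Suc h" "lex_power m E (Suc h) (v i) w"
      "lex_power m E (Suc h) w (v j)" "lex_power m E (Suc h) w (v k)"
      using fam unfolding branch_family_def by blast
    then have "w div m ^ h = c"
      using ijk asym by (auto split: if_splits)
    moreover have "m ^ h > 0"
      using w(1) by (auto intro!: Nat.gr0I)
    ultimately show "\<exists>w\<in>{..<m ^ h}. lex_power m E h (?u i) w \<and>
        lex_power m E h w (?u j) \<and> lex_power m E h w (?u k)"
      using w ijk by (intro bexI[of _ "w mod m ^ h"]) auto
  qed
qed

text \<open>The key step: a subdivision vertex below \<open>v i\<close> and above a vertex of the same cell
  lies in that cell itself, so it can only dominate another cell that is dominated by
  this one.\<close>

lemma branch_family_cells_transitive:
  assumes E: "tournament_rel {..<m} E"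
    and fam: "branch_family {..<m ^ Suc h} (lex_power m E (Suc h)) I v"
    and ijk: "i \<in> I" "j \<in> I" "k \<in> I" "i < j" "i < k"
    and cells: "v j div m ^ h = v i div m ^ h" "v k div m ^ h \<noteq> v i div m ^ h"
  shows "E (v i div m ^ h) (v k div m ^ h)"
proof -
  have asym: "\<not> E y x" if "E x y" for x y
    using E that by (auto simp: tournament_rel_def)
  have "j \<noteq> k"
    using cells by auto
  \<comment> \<open>The condition on \<open>w\<close> is symmetric in the two larger indices, so
    either order of \<open>j\<close> and \<open>k\<close> will do.\<close>
  then obtain w where w: "lex_power m E (Suc h) (v i) w"
      "lex_power m E (Suc h) w (v j)" "lex_power m E (Suc h) w (v k)"
    using fam ijk unfolding branch_family_def by (metis linorder_neqE_nat)
  then have "w div m ^ h = v i div m ^ h"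
    using cells(1) asym by (auto split: if_splits)
  then show ?thesis
    using w(3) cells(2) by simp
qed

text \<open>One level turns a bound \<open>a\<close> into \<open>m + L * a\<close>: one vertex for
  each cell, and at most \<open>L\<close> big cells treated by induction. The summand
  \<open>m\<close> on the left absorbs the additive term because
  \<open>2 * m \<le> L * m\<close>.\<close>

lemma card_branch_family_le:
  assumes E: "tournament_rel {..<m} E"
    and trans: "\<And>xs. set xs \<subseteq> {..<m} \<Longrightarrow> sorted_wrt E xs \<Longrightarrow> length xs \<le> L"
    and "L \<ge> 2"
    and "finite I" and "branch_family {..<m ^ h} (lex_power m E h) I v"
  shows "card I + m \<le> (m + 1) * L ^ h"
  using assms(4,5)
proof (induction h arbitrary: I v)
  case 0
  then have "inj_on v I" "v ` I \<subseteq> {0}"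
    by (auto simp: branch_family_def)
  then have "card I \<le> card {0::nat}"
    using card_inj_on_le by blast
  then show ?case
    by simp
next
  case (Suc h)
  define cell where "cell i = v i div m ^ h" for i
  define J where "J c = {i \<in> I. cell i = c}" for c
  define Big where "Big = {c \<in> {..<m}. card (J c) \<ge> 2}"
  have finJ: "finite (J c)" for c
    using Suc.prems(1) by (simp add: J_def)
  have cell_less: "cell i < m" if "i \<in> I" for i
    using that Suc.prems(2) by (auto simp: branch_family_def cell_def less_mult_imp_div_less)
  have IH: "card (J c) + m \<le> (m + 1) * L ^ h" for c
    unfolding J_def cell_def
    by (rule Suc.IH[OF _ branch_family_cell[OF E Suc.prems(2)]]) (use Suc.prems(1) in simp)
  define first where "first c = Min (J c)" for c
  have first: "first c \<in> J c" "\<And>i. i \<in> J c \<Longrightarrow> first c \<le> i" if "c \<in> Big" for c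
  proof -
    have "J c \<noteq> {}"
      using that by (auto simp: Big_def)
    then show "first c \<in> J c" "\<And>i. i \<in> J c \<Longrightarrow> first c \<le> i"
      using finJ by (simp_all add: first_def)
  qed
  define F where "F = first ` Big"
  have inj: "inj_on first Big"
  proof (rule inj_onI)
    fix c d assume "c \<in> Big" "d \<in> Big" "first c = first d"
    then show "c = d"
      using first(1)[of c] first(1)[of d] by (auto simp: J_def)
  qed
  have finF: "finite F"
    by (simp add: F_def Big_def)
  have cellF: "E (cell a) (cell b)" if ab: "a \<in> F" "b \<in> F" "a < b" for a b
  proof -
    obtain c d where cd: "c \<in> Big" "d \<in> Big" "a = first c" "b = first d"
      using ab by (auto simp: F_def)
    then have cells: "a \<in> I" "b \<in> I" "cell a = c" "cell b = d"
      using first(1) by (auto simp: J_def)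
    have "c \<noteq> d"
      using cd ab(3) by auto
    \<comment> \<open>A big cell holds a second branch index \<open>a'\<close>, which is larger than
      the first one \<open>a\<close>; the triple of \<open>a\<close>, \<open>a'\<close>,
      \<open>b\<close> then forces the arc.\<close>
    have "\<not> J c \<subseteq> {a}"
      using cd(1) card_mono[of "{a}" "J c"] by (auto simp: Big_def)
    then obtain a' where a': "a' \<in> J c" "a' \<noteq> a"
      by blast
    then have "a < a'"
      using first(2)[OF cd(1)] cd(3) by (simp add: order.not_eq_order_implies_strict)
    then show ?thesis
      using branch_family_cells_transitive[OF E Suc.prems(2), of a a' b] cells a' ab(3) \<open>c \<noteq> d\<close>
      by (simp add: J_def cell_def)
  qed
  \<comment> \<open>Listed by their first indices, the big cells form a transitive subtournament of
    \<open>E\<close>.\<close>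
  let ?xs = "map cell (sorted_list_of_set F)"
  have "sorted_wrt E ?xs"
    unfolding sorted_wrt_map
    by (rule sorted_wrt_mono_rel[OF _ strict_sorted_list_of_set]) (use cellF finF in auto)
  moreover have "set ?xs \<subseteq> {..<m}"
    using finF cell_less first(1) by (auto simp: F_def J_def)
  ultimately have "card F \<le> L"
    using trans[of ?xs] by simp
  then have cardBig: "card Big \<le> L"
    using inj by (simp add: F_def card_image)
  have "I = (\<Union>c<m. J c)"
    using cell_less by (auto simp: J_def)
  then have "card I \<le> (\<Sum>c<m. card (J c))"
    using card_UN_le[of "{..<m}" J] by simp
  \<comment> \<open>Every cell is charged 1, which covers the cells outside \<open>Big\<close>; big
    cells are charged their size on top.\<close>
  also have "\<dots> \<le> (\<Sum>c<m. 1 + (if c \<in> Big then card (J c) else 0))"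
    by (rule sum_mono) (auto simp: Big_def)
  also have "\<dots> = m + (\<Sum>c\<in>Big. card (J c))"
    by (simp only: sum.distrib) (simp add: sum.If_cases Big_def Collect_conj_eq lessThan_def)
  also have "(\<Sum>c\<in>Big. card (J c)) \<le> card Big * ((m + 1) * L ^ h - m)"
    by (rule sum_bounded_above[where K = "(m + 1) * L ^ h - m", simplified of_nat_id])
      (rule add_le_imp_le_diff[OF IH])
  also have "\<dots> \<le> L * ((m + 1) * L ^ h - m)"
    using cardBig by simp
  finally have "card I + m \<le> 2 * m + L * ((m + 1) * L ^ h - m)"
    by simp
  also have "\<dots> \<le> L * m + L * ((m + 1) * L ^ h - m)"
    using \<open>L \<ge> 2\<close> by simp
  \<comment> \<open>The induction hypothesis at an arbitrary cell gives
    \<open>m \<le> (m + 1) * L ^ h\<close>, so the truncated subtraction is exact.\<close>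
  also have "\<dots> = L * ((m + 1) * L ^ h)"
    using IH[of 0] by (simp flip: distrib_left)
  finally show ?case
    by (simp add: algebra_simps)
qed

section \<open>Oriented Ramsey numbers\<close>

text \<open>Makes the \<open>LEAST\<close> in \<open>oriented_ramsey\<close> meaningful. Ramsey's
  theorem yields a transitive subtournament on \<open>M\<close> vertices, and the topological
  numbering \<open>g\<close> places \<open>D\<close> along it.\<close>

lemma exists_tournament_size_containing_copy:
  fixes D :: "'b pair_pre_digraph" and g :: "'b \<Rightarrow> nat"
  assumes inj: "inj_on g (pverts D)" and bound: "g ` pverts D \<subseteq> {..<M}"
    and wf: "pair_wf_digraph D"
    and incr: "\<And>u v. (u, v) \<in> parcs D \<Longrightarrow> g u < g v"
  shows "\<exists>N. \<forall>T :: nat pair_pre_digraph. tournament T \<and> card (pverts T) = N \<longrightarrow> contains_copy T D"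
proof -
  obtain r where r: "r \<ge> 1" "\<And>(V :: nat set) E. finite V \<Longrightarrow> card V \<ge> r \<Longrightarrow>
      \<exists>R\<subseteq>V. card R = M \<and> clique R E \<or> card R = M \<and> indep R E"
    using ramsey2[of M M] by blast
  have "contains_copy T D" if T: "tournament T" "card (pverts T) = r" for T :: "nat pair_pre_digraph"
  proof -
    \<comment> \<open>Two-colours the pairs by whether their arc goes up or down in the order of
      \<open>nat\<close>.\<close>
    define E where "E = {{x, y} | x y. x < y \<and> (x, y) \<in> parcs T}"
    have E_iff: "{x, y} \<in> E \<longleftrightarrow> (x, y) \<in> parcs T" if "x < y" for x y
      using that by (auto simp: E_def doubleton_eq_iff)
    have "finite (pverts T)"
      using T r(1) by (intro card_ge_0_finite) simp
    then obtain R where R: "R \<subseteq> pverts T" "card R = M" "clique R E \<or> indep R E"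
      using r(2)[of "pverts T" E] T(2) by blast
    have finR: "finite R"
      using R(1) \<open>finite (pverts T)\<close> finite_subset by blast
    have "\<exists>xs. set xs = R \<and> sorted_wrt (\<lambda>x y. (x, y) \<in> parcs T) xs \<and> distinct xs"
      using R(3)
    proof
      assume "clique R E"
      then have "(x, y) \<in> parcs T" if "x \<in> R" "y \<in> R" "x < y" for x y
        using that E_iff[of x y] by (auto simp: clique_def)
      then have "sorted_wrt (\<lambda>x y. (x, y) \<in> parcs T) (sorted_list_of_set R)"
        by (intro sorted_wrt_mono_rel[OF _ strict_sorted_list_of_set]) (use finR in auto)
      then show ?thesis
        using finR by (intro exI[of _ "sorted_list_of_set R"]) simp
    next
      assume indep: "indep R E"
      have "(y, x) \<in> parcs T" if "x \<in> R" "y \<in> R" "x < y" for x y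
      proof -
        have "(x, y) \<notin> parcs T"
          using that indep E_iff[of x y] by (auto simp: indep_def)
        moreover have "((x, y) \<in> parcs T) \<noteq> ((y, x) \<in> parcs T)"
          by (rule T(1)[unfolded tournament_def, THEN conjunct2, rule_format])
            (use that R(1) in auto)
        ultimately show ?thesis
          by simp
      qed
      \<comment> \<open>All arcs of an independent set go down, so the reversed list is the
        transitive order.\<close>
      then have "sorted_wrt (\<lambda>x y. (y, x) \<in> parcs T) (sorted_list_of_set R)"
        by (intro sorted_wrt_mono_rel[OF _ strict_sorted_list_of_set]) (use finR in auto)
      then show ?thesis
        using finR by (intro exI[of _ "rev (sorted_list_of_set R)"]) (simp add: sorted_wrt_rev)
    qed
    then obtain xs where xs: "set xs = R" "sorted_wrt (\<lambda>x y. (x, y) \<in> parcs T) xs" "distinct xs"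
      by blast
    have len: "length xs = M"
      using xs R(2) distinct_card by metis
    have less: "g u < M" if "u \<in> pverts D" for u
      using bound that by auto
    show ?thesis
      unfolding contains_copy_def
    proof (intro exI[of _ "\<lambda>u. xs ! g u"] conjI)
      show "inj_on (\<lambda>u. xs ! g u) (pverts D)"
        using inj xs(3) less by (auto simp: inj_on_def nth_eq_iff_index_eq len)
      show "(\<lambda>u. xs ! g u) ` pverts D \<subseteq> pverts T"
        using less R(1) xs(1) len nth_mem by fastforce
      show "\<forall>(u, v)\<in>parcs D. (xs ! g u, xs ! g v) \<in> parcs T"
      proof clarify
        fix u v assume uv: "(u, v) \<in> parcs D"
        then have "v \<in> pverts D"
          using pair_wf_digraph.arc_snd_in_verts[OF wf] by fastforce
        then show "(xs ! g u, xs ! g v) \<in> parcs T"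
          using incr[OF uv] less xs(2) len by (auto simp: sorted_wrt_iff_nth_less)
      qed
    qed
  qed
  then show ?thesis
    by blast
qed

text \<open>In base \<open>b\<close> the digits \<open>j\<close>, \<open>k\<close> together are
  worth less than one unit of the leading digit. Serves to bound a numbering of the subdivision and
  to show that it increases along arcs.\<close>

lemma digits_less:
  fixes i j k i' j' b :: nat
  assumes "i < i'" and "j < b" and "k < b"
  shows "(i * b + j) * b + k < (i' * b + j') * b"
proof -
  have "i * b + j < Suc i * b"
    using assms by simp
  also have "\<dots> \<le> i' * b + j'"
    using assms(1) by (intro trans_le_add1 mult_right_mono) auto
  finally have "Suc (i * b + j) * b \<le> (i' * b + j') * b"
    by (intro mult_right_mono) auto
  then show ?thesis
    using assms(3) by simp
qed

text \<open>The least size has the defining property as soon as some size has it, which a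
  topological numbering of the subdivision provides.\<close>

lemma oriented_ramsey_subdivision_12_property:
  fixes T :: "nat pair_pre_digraph"
  assumes "tournament T" and "card (pverts T) = oriented_ramsey (subdivision_12 n)"
  shows "contains_copy T (subdivision_12 n)"
proof -
  define b where "b = Suc n"
  \<comment> \<open>Branch vertex \<open>i\<close> gets the base-\<open>b\<close> digits
    \<open>i, 0, 0\<close> and a triple its own entries, so each triple comes after \<open>i\<close>
    and before \<open>Suc i\<close>.\<close>
  define g :: "nat + nat \<times> nat \<times> nat \<Rightarrow> nat"
    where "g = case_sum (\<lambda>i. (i * b + 0) * b + 0) (\<lambda>(i, j, k). (i * b + j) * b + k)"
  have digits: "i = i' \<and> j = j' \<and> k = k'"
    if "(i * b + j) * b + k = (i' * b + j') * b + k'" "j < b" "k < b" "j' < b" "k' < b"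
    for i j k i' j' k'
  proof -
    have 1: "x = x' \<and> y = y'" if "x * b + y = x' * b + y'" "y < b" "y' < b" for x y x' y'
      using arg_cong[OF that(1), of "\<lambda>z. z div b"] arg_cong[OF that(1), of "\<lambda>z. z mod b"] that(2,3)
      by simp
    show ?thesis
      using 1[OF that(1,3,5)] 1[of i j i' j'] that(2,4) by blast
  qed
  have "\<exists>N. \<forall>T :: nat pair_pre_digraph.
      tournament T \<and> card (pverts T) = N \<longrightarrow> contains_copy T (subdivision_12 n)"
  proof (rule exists_tournament_size_containing_copy)
    show "inj_on g (pverts (subdivision_12 n))"
    proof (rule inj_onI)
      fix x y assume xy: "x \<in> pverts (subdivision_12 n)" "y \<in> pverts (subdivision_12 n)" "g x = g y"
      \<comment> \<open>The middle digit tells the two kinds of vertices apart.\<close>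
      have code: "\<exists>i j k. g z = (i * b + j) * b + k \<and> j < b \<and> k < b \<and>
          (z = Inl i \<and> j = 0 \<and> k = 0 \<or> z = Inr (i, j, k) \<and> 0 < j)"
        if "z \<in> pverts (subdivision_12 n)" for z
        using that by (fastforce simp: subdivision_12_def g_def b_def)
      obtain i j k where x: "g x = (i * b + j) * b + k" "j < b" "k < b"
        "x = Inl i \<and> j = 0 \<and> k = 0 \<or> x = Inr (i, j, k) \<and> 0 < j"
        using code[OF xy(1)] by blast
      obtain i' j' k' where y: "g y = (i' * b + j') * b + k'" "j' < b" "k' < b"
        "y = Inl i' \<and> j' = 0 \<and> k' = 0 \<or> y = Inr (i', j', k') \<and> 0 < j'"
        using code[OF xy(2)] by blast
      have "i = i' \<and> j = j' \<and> k = k'"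
        using xy(3) x(1-3) y(1-3) by (intro digits) auto
      then show "x = y"
        using x(4) y(4) by auto
    qed
    show "g ` pverts (subdivision_12 n) \<subseteq> {..<(Suc n * b + 0) * b}"
      using digits_less[of _ "Suc n" _ b _ 0]
      by (auto simp: subdivision_12_def g_def b_def simp del: mult_Suc mult_Suc_right add_0_right)
    show "pair_wf_digraph (subdivision_12 n)"
      using pair_digraph_subdivision_12 pair_digraph.axioms(1) pair_fin_digraph.axioms(1) by blast
    show "g u < g v" if "(u, v) \<in> parcs (subdivision_12 n)" for u v
    proof -
      obtain i j k where ijk: "1 \<le> i" "i < j" "j < k" "k \<le> n"
        and uv: "(u, v) = (Inl i, Inr (i, j, k)) \<or> (u, v) = (Inr (i, j, k), Inl j) \<or>
          (u, v) = (Inr (i, j, k), Inl k)"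
        using \<open>(u, v) \<in> parcs (subdivision_12 n)\<close> by (auto simp: subdivision_12_def)
      have "(i * b + 0) * b + 0 < (i * b + j) * b + k"
        using ijk by (simp add: add_mult_distrib)
      moreover have "(i * b + j) * b + k < (j * b + 0) * b" "(i * b + j) * b + k < (k * b + 0) * b"
        by (rule digits_less; use ijk in \<open>simp add: b_def\<close>)+
      ultimately show ?thesis
        using uv by (auto simp: g_def)
    qed
  qed
  from LeastI_ex[OF this, folded oriented_ramsey_def] show ?thesis
    using assms by blast
qed

section \<open>From relations to digraphs, and from copies to branch families\<close>

definition rel_digraph :: "nat set \<Rightarrow> (nat \<Rightarrow> nat \<Rightarrow> bool) \<Rightarrow> nat pair_pre_digraph" where
  "rel_digraph V E = \<lparr>pverts = V, parcs = {(u, v). u \<in> V \<and> v \<in> V \<and> E u v}\<rparr>"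

text \<open>The passage to a subset \<open>V\<close> cuts a large tournament down to exactly
  \<open>oriented_ramsey\<close> many vertices, the only size of which the Ramsey property
  speaks.\<close>

lemma tournament_rel_digraph:
  assumes "tournament_rel W E" and "V \<subseteq> W" and "finite V"
  shows "tournament (rel_digraph V E)"
proof -
  have irrefl: "\<not> E u u" for u
    using assms(1) by (auto simp: tournament_rel_def)
  have "pair_digraph (rel_digraph V E)"
  proof unfold_locales
    show "finite (parcs (rel_digraph V E))"
      unfolding rel_digraph_def using assms(3)
      by (auto intro: finite_subset[of _ "V \<times> V"])
  qed (use assms(3) irrefl in \<open>auto simp: rel_digraph_def\<close>)
  moreover have "((u, v) \<in> parcs (rel_digraph V E)) \<noteq> ((v, u) \<in> parcs (rel_digraph V E))"
    if "u \<in> V" "v \<in> V" "u \<noteq> v" for u v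
  proof -
    have "E u v \<or> E v u" "\<not> (E u v \<and> E v u)"
      using that assms(1,2) unfolding tournament_rel_def by blast+
    then show ?thesis
      using that by (auto simp: rel_digraph_def)
  qed
  moreover have "pverts (rel_digraph V E) = V"
    by (simp add: rel_digraph_def)
  ultimately show ?thesis
    unfolding tournament_def by (intro conjI ballI impI) (simp_all only:)
qed

text \<open>The images of the subdivision vertices are the witnesses. Going up from \<open>V\<close>
  to \<open>W\<close> returns from the cut tournament to the full power.\<close>

lemma branch_family_of_copy:
  assumes "contains_copy (rel_digraph V E) (subdivision_12 n)" and "V \<subseteq> W"
  shows "\<exists>v. branch_family W E {1..n} v"
proof -
  obtain f where f: "inj_on f (pverts (subdivision_12 n))"
      "f ` pverts (subdivision_12 n) \<subseteq> V"
      "\<And>u v. (u, v) \<in> parcs (subdivision_12 n) \<Longrightarrow> f u \<in> V \<and> f v \<in> V \<and> E (f u) (f v)"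
    using assms(1) unfolding contains_copy_def rel_digraph_def by fastforce
  have "branch_family W E {1..n} (\<lambda>i. f (Inl i))"
    unfolding branch_family_def
  proof (intro conjI ballI impI)
    show "inj_on (\<lambda>i. f (Inl i)) {1..n}"
    proof (rule inj_onI)
      fix i j assume ij: "i \<in> {1..n}" "j \<in> {1..n}" "f (Inl i) = f (Inl j)"
      have "(Inl i :: nat + nat \<times> nat \<times> nat) = Inl j"
        by (rule inj_onD[OF f(1) ij(3)]) (use ij(1,2) in \<open>auto simp: subdivision_12_def\<close>)
      then show "i = j"
        by simp
    qed
    show "(\<lambda>i. f (Inl i)) ` {1..n} \<subseteq> W"
    proof -
      have "(Inl i :: nat + nat \<times> nat \<times> nat) \<in> pverts (subdivision_12 n)" if "i \<in> {1..n}" for i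
        using that by (simp add: subdivision_12_def)
      then show ?thesis
        using f(2) assms(2) by blast
    qed
  next
    fix i j k assume "i \<in> {1..n}" "j \<in> {1..n}" "k \<in> {1..n}" "i < j" "j < k"
    then have "(Inl i, Inr (i, j, k)) \<in> parcs (subdivision_12 n)"
      "(Inr (i, j, k), Inl j) \<in> parcs (subdivision_12 n)"
      "(Inr (i, j, k), Inl k) \<in> parcs (subdivision_12 n)"
      by (auto simp: subdivision_12_def)
    then show "\<exists>w\<in>W. E (f (Inl i)) w \<and> E w (f (Inl j)) \<and> E w (f (Inl k))"
      using f(3) assms(2) by blast
  qed
  then show ?thesis
    by blast
qed

text \<open>A copy needs \<open>n\<close> distinct branch vertices. This settles the range where the
  claimed exponent is at most 1.\<close>

lemma oriented_ramsey_subdivision_12_ge: "n \<le> oriented_ramsey (subdivision_12 n)"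
proof -
  define N where "N = oriented_ramsey (subdivision_12 n)"
  have "tournament (rel_digraph {..<N} (\<lambda>x y. x < y))"
    by (rule tournament_rel_digraph[of "{..<N}"]) (auto simp: tournament_rel_def)
  then have "contains_copy (rel_digraph {..<N} (\<lambda>x y. x < y)) (subdivision_12 n)"
    by (rule oriented_ramsey_subdivision_12_property) (simp add: rel_digraph_def N_def)
  then obtain v where "branch_family {..<N} (\<lambda>x y. x < y) {1..n} v"
    using branch_family_of_copy by blast
  then have "card {1..n} \<le> card {..<N}"
    by (intro card_inj_on_le[of v]) (auto simp: branch_family_def)
  then show ?thesis
    by (simp add: N_def)
qed

text \<open>Otherwise the \<open>h\<close>-fold power could be cut down to the Ramsey size, and the
  copy found there would give a branch family of size \<open>n\<close> that is too large.\<close>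

lemma oriented_ramsey_subdivision_12_gt_power:
  assumes "m\<^sup>2 < 2 ^ L" and "L \<ge> 2" and "(m + 1) * L ^ h < n + m"
  shows "m ^ h < oriented_ramsey (subdivision_12 n)"
proof (rule ccontr)
  define N where "N = oriented_ramsey (subdivision_12 n)"
  assume "\<not> m ^ h < oriented_ramsey (subdivision_12 n)"
  then have sub: "{..<N} \<subseteq> {..<m ^ h}"
    by (auto simp: N_def)
  obtain E where E: "tournament_rel {..<m} E"
    "\<And>xs. set xs \<subseteq> {..<m} \<Longrightarrow> sorted_wrt E xs \<Longrightarrow> length xs \<le> L"
    using exists_tournament_no_large_transitive[OF assms(1)] by blast
  let ?T = "rel_digraph {..<N} (lex_power m E h)"
  have "tournament ?T"
    using tournament_rel_digraph[OF tournament_lex_power[OF E(1)] sub] by simp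
  then have "contains_copy ?T (subdivision_12 n)"
    by (rule oriented_ramsey_subdivision_12_property) (simp add: rel_digraph_def N_def)
  then obtain v where "branch_family {..<m ^ h} (lex_power m E h) {1..n} v"
    using branch_family_of_copy[OF _ sub] by blast
  from card_branch_family_le[OF E assms(2) _ this] show False
    using assms(3) by simp
qed

section \<open>The choice of parameters\<close>

text \<open>The bound \<open>1 - 1 / y \<le> ln y\<close> already excludes \<open>103 / 100 \<le> y \<le> 98\<close>.\<close>

lemma large_of_gt_100_ln:
  fixes y :: real
  assumes "y \<ge> 103 / 100" and "y > 100 * ln y"
  shows "y > 400" and "ln y > 4"
proof -
  have "ln y \<ge> 1 - 1 / y"
    using ln_le_minus_one[of "1 / y"] assms(1) by (simp add: ln_div)
  then have "y > 100 * (1 - 1 / y)"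
    using assms(2) by simp
  then have "y * y > 100 * (y - 1)"
    using assms(1) by (simp add: field_simps)
  \<comment> \<open>A quadratic with rational roots that exceeds
    \<open>y * y - 100 * (y - 1)\<close> by a positive amount.\<close>
  moreover have "(y - 103 / 100) * (y - 98) = y * y - 9903 / 100 * y + 10094 / 100"
    by (simp add: field_simps)
  ultimately have "(y - 103 / 100) * (y - 98) > 0"
    using assms(1) by argo
  then have y98: "y > 98"
    using assms(1) by (simp add: zero_less_mult_iff)
  \<comment> \<open>Bootstrapping: \<open>exp 4 \<le> 81 < 98\<close> gives \<open>ln y > 4\<close>,
    and the hypothesis then lifts \<open>y\<close> above 400.\<close>
  have "exp (4::real) = exp 1 ^ 4"
    by (simp flip: exp_of_nat_mult)
  also have "\<dots> \<le> 3 ^ 4"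
    using exp_le by (intro power_mono) auto
  finally have "exp 4 < y"
    using y98 by simp
  then have "ln (exp 4) < ln y"
    by (subst ln_less_cancel_iff) (use y98 in auto)
  then show "ln y > 4"
    by simp
  then show "y > 400"
    using assms(2) by simp
qed

lemma ln_2_bounds: "1 / 2 \<le> ln (2::real)" "ln (2::real) \<le> 1"
proof -
  show "ln (2::real) \<le> 1"
    using ln_le_minus_one[of 2] by simp
  show "1 / 2 \<le> ln (2::real)"
    using ln_le_minus_one[of "1 / 2"] by (simp add: ln_div)
qed

text \<open>Keeps \<open>ln n\<close> away from the values just above 1, where
  \<open>y > 100 * ln y\<close> holds although \<open>y\<close> is small.\<close>

lemma ln_3_ge: "103 / 100 \<le> ln (3::real)"
proof -
  \<comment> \<open>\<open>exp_bound\<close> needs an argument at most 1; at an eighth of the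
    exponent it is also sharp enough.\<close>
  have "exp (103 / 100 :: real) = exp (103 / 800) ^ 8"
    by (simp flip: exp_of_nat_mult)
  also have "\<dots> \<le> (1 + 103 / 800 + (103 / 800)\<^sup>2) ^ 8"
    by (intro power_mono exp_bound) auto
  also have "\<dots> \<le> 3"
    by (simp add: power2_eq_square power_divide)
  finally show ?thesis
    by (subst ln_ge_iff) auto
qed

theorem theorem3p2:
  fixes n :: nat
  assumes "n \<ge> 3"
  shows "real (oriented_ramsey (subdivision_12 n))
           \<ge> real n powr (ln (real n) / (100 * ln (ln (real n))))"
proof -
  define y where "y = ln (real n)"
  have n: "real n > 0" "real n = exp y"
    using assms by (simp_all add: y_def)
  have "103 / 100 \<le> ln (3::real)"
    by (rule ln_3_ge)
  also have "\<dots> \<le> y"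
    using assms by (simp add: y_def)
  finally have y: "y \<ge> 103 / 100" .
  then have lny: "ln y > 0"
    by simp
  have powr: "real n powr (y / (100 * ln y)) = exp (y * y / (100 * ln y))"
    unfolding n(2) by (simp add: powr_def)
  show ?thesis
  proof (cases "y \<le> 100 * ln y")
    case True
    then have "real n powr (y / (100 * ln y)) \<le> real n powr 1"
      using assms lny by (intro powr_mono) (auto simp: field_simps)
    also have "\<dots> \<le> real (oriented_ramsey (subdivision_12 n))"
      using n oriented_ramsey_subdivision_12_ge[of n] by simp
    finally show ?thesis
      by (simp add: y_def)
  next
    case False
    then have big: "y > 400" "ln y > 4"
      using large_of_gt_100_ln[of y] y by simp_all
    \<comment> \<open>With \<open>m = 2 ^ s\<close> about \<open>n powr (ln 2 / 3)\<close>, and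
      \<open>L \<le> y\<close>, these choices make \<open>m\<close> at most the cube root and
      \<open>L ^ h\<close> at most the square root of \<open>n\<close>.\<close>
    define s where "s = nat \<lfloor>y / 3\<rfloor>"
    define h where "h = nat \<lfloor>y / (2 * ln y)\<rfloor>"
    have floor: "real (nat \<lfloor>x\<rfloor>) \<le> x" "real (nat \<lfloor>x\<rfloor>) \<ge> x - 1" if "x \<ge> 0" for x :: real
      using that by linarith+
    have s: "real s \<le> y / 3" "real s \<ge> y / 3 - 1"
      unfolding s_def using big by (intro floor; simp)+
    have h: "real h \<le> y / (2 * ln y)" "real h \<ge> y / (2 * ln y) - 1"
      unfolding h_def using big by (intro floor; simp)+
    let ?m = "2 ^ s :: nat" and ?L = "2 * s + 1"
    have m_exp: "real ?m = exp (real s * ln 2)"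
      by (simp add: powr_realpow[symmetric] powr_def)
    have "real ?m \<le> exp (y / 3)"
    proof -
      have "real s * ln 2 \<le> real s * 1"
        using ln_2_bounds by (intro mult_left_mono) auto
      then show ?thesis
        using s(1) m_exp by simp
    qed
    moreover have "1 \<le> exp (y / 3)"
      using big by simp
    ultimately have m1: "real (?m + 1) \<le> 2 * exp (y / 3)"
      by linarith
    have "real ?L \<le> y"
      using s(1) big by simp
    then have "real (?L ^ h) \<le> y ^ h"
      by (simp add: power_mono del: of_nat_Suc of_nat_add)
    also have "\<dots> = exp (real h * ln y)"
      using big by (simp add: powr_realpow[symmetric] powr_def)
    also have "\<dots> \<le> exp (y / 2)"
      using h(1) lny by (simp add: field_simps)
    finally have Lh: "real (?L ^ h) \<le> exp (y / 2)" .
    \<comment> \<open>The product has order at most \<open>n powr (5 / 6)\<close>; the spare sixth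
      of the exponent absorbs the factor 2.\<close>
    have two: "2 < exp (y / 6)"
      using exp_ge_add_one_self[of "y / 6"] big by linarith
    have "real ((?m + 1) * ?L ^ h) \<le> 2 * exp (y / 3) * exp (y / 2)"
      unfolding of_nat_mult by (rule mult_mono[OF m1 Lh]) auto
    also have "\<dots> = 2 * exp (5 * y / 6)"
      by (simp flip: exp_add)
    also have "\<dots> < exp (y / 6) * exp (5 * y / 6)"
      using two by simp
    also have "\<dots> = real n"
      by (simp add: n(2) flip: exp_add)
    finally have "(?m + 1) * ?L ^ h < n"
      by linarith
    \<comment> \<open>The \<open>+ 1\<close> in \<open>?L\<close> makes this inequality
      strict.\<close>
    moreover have "?m\<^sup>2 < 2 ^ ?L"
      by (simp add: power_mult[symmetric] mult.commute)
    moreover have "?L \<ge> 2"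
      using s(2) big by linarith
    ultimately have ram: "?m ^ h < oriented_ramsey (subdivision_12 n)"
      by (intro oriented_ramsey_subdivision_12_gt_power[of _ ?L]) auto
    have "y / 10 \<le> real s * ln 2"
    proof -
      have "y / 10 \<le> real s * (1 / 2)"
        using s(2) big by simp
      also have "\<dots> \<le> real s * ln 2"
        using ln_2_bounds by (intro mult_left_mono) auto
      finally show ?thesis .
    qed
    moreover have "y / (10 * ln y) \<le> real h"
    proof -
      \<comment> \<open>The two quotients differ by \<open>4 / 10 * (y / ln y)\<close>, which
        exceeds 40 in this case and so covers the 1 lost to the floor.\<close>
      have "y / (10 * ln y) + 1 \<le> y / (2 * ln y)"
        using False lny by (simp add: field_simps)
      then show ?thesis
        using h(2) by linarith
    qed
    ultimately have "y / (10 * ln y) * (y / 10) \<le> real h * (real s * ln 2)"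
      using big lny by (intro mult_mono) auto
    then have "exp (y * y / (100 * ln y)) \<le> exp (real h * (real s * ln 2))"
      by (simp add: field_simps)
    also have "\<dots> = real (?m ^ h)"
      by (simp only: of_nat_power[of ?m] m_exp exp_of_nat_mult)
    also have "\<dots> \<le> real (oriented_ramsey (subdivision_12 n))"
      using ram by linarith
    finally show ?thesis
      using powr by (simp add: y_def)
  qed
qed

end
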